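(* For $(\mathrm{Epi}(\mathsf{FinISet}),-/\mathrm{Epi}(\mathsf{FinISet}))$: (1) the universal baseless $\mathsf{OrdCMon}$-entropy is $A\mapsto\log|A|$, $\mathrm{Epi}(\mathsf{FinISet})\to\log\mathbb{N}$, and the same map is the universal baseless $\mathsf{COrdCMon}$-entropy and the universal baseless $\mathsf{IcOrdCMon}$-entropy; (2) the universal baseless $\mathsf{OrdAb}$-entropy is $A\mapsto\log|A|$, $\mathrm{Epi}(\mathsf{FinISet})\to\log\mathbb{Q}_{>0}$, and the same for $\mathsf{IcOrdAb}$; (3) the universal baseless $\mathsf{OrdVect}_{\mathbb{Q}}$-entropy is $A\mapsto\log|A|$, $\mathrm{Epi}(\mathsf{FinISet})\to\mathbb{Q}\log\mathbb{Q}_{>0}$, and the same for $\mathsf{IcOrdVect}_{\mathbb{Q}}$.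
   Context: **The category.** $\mathsf{C}=\mathrm{Epi}(\mathsf{FinISet})$ has finite nonempty sets as objects and surjections as morphisms; tensor product: cartesian product; unit $I$: a singleton. The under category $A/\mathsf{C}$ has objects surjections $f:A\to B$ and morphisms $f\to f'$ given by surjections $k:B\to B'$ with $kf=f'$. It is monoidal: for $f:A\to B$, $g:A\to C$, $f\otimes_Ag:A\to\mathrm{im}((f,g))$ is $(f,g):A\to B\times C$ with codomain restricted to its image; its unit $I_A$ is $A\to I$. **Codomains.** $\mathbb{N}=\{1,2,\dots\}$; $\log\mathbb{N}=\{\log n\}$, $\log\mathbb{Q}_{>0}=\{\log q:q\in\mathbb{Q}_{>0}\}$, $\mathbb{Q}\log\mathbb{Q}_{>0}=\{a\log b:a\in\mathbb{Q},b\in\mathbb{Q}_{>0}\}$, all with addition and order inherited from $\mathbb{R}$. $\mathsf{OrdCMon}$: partially ordered commutative monoids ($x\ge y,z\ge w\Rightarrow x+z\ge y+w$) and order-preserving homomorphisms; $\mathsf{COrdCMon}$: the full subcategory of cancellative ones ($x+z\ge y+z\Rightarrow x\ge y$); $\mathsf{IcOrdCMon}$: the full subcategory of integrally closed ones (if $nx+a\ge ny+b$ for all integers $n\ge1$ then $x\ge y$); $\mathsf{OrdAb}$: partially ordered abelian groups and order-preserving homomorphisms; $\mathsf{OrdVect}_{\mathbb{Q}}$: ordered $\mathbb{Q}$-vector spaces (translation-invariant partial order with $x\ge y\Rightarrow ax\ge ay$ for rational $a\ge0$) and order-preserving linear maps; $\mathsf{IcOrdAb}$, $\mathsf{IcOrdVect}_{\mathbb{Q}}$: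 the full subcategories of integrally closed objects. **Entropies.** For $\mathsf{V}$ one of these categories, a $\mathsf{V}$-entropy of $(\mathsf{C},-/\mathsf{C})$ with values in $W\in\mathsf{V}$ is a monoidal natural transformation $h:-/\mathsf{C}\Rightarrow\Delta_W$ ($W$ viewed as a monoidal category with $a\to b$ iff $a\ge b$); unpacked: functions $h_P:\mathrm{Ob}(P/\mathsf{C})\to W$, $P\in\mathsf{C}$, such that (1) $h_P(X)\ge h_P(X')$ if there is a morphism $X\to X'$ in $P/\mathsf{C}$; (2) $h_P(X)+h_P(Y)\ge h_P(X\otimes_PY)$ and $0\ge h_P(I_P)$; (3) $h_P(X\circ f)=h_Q(X)$ for $f:P\to Q$ in $\mathsf{C}$, $X\in Q/\mathsf{C}$; (4) $h_{P\otimes Q}(X\otimes Y)=h_P(X)+h_Q(Y)$ for $X\in P/\mathsf{C}$, $Y\in Q/\mathsf{C}$, and $h_I(I_I)=0$. The corresponding baseless $\mathsf{V}$-entropy is $H(P)=h_P(\mathrm{id}_P)$ (so $h_P(X)=H(A)$ for $X:P\to A$). A baseless $\mathsf{V}$-entropy $H$ into $W$ is universal if for every baseless $\mathsf{V}$-entropy $H'$ into $W'\in\mathsf{V}$ there is a unique morphism $t:W\to W'$ in $\mathsf{V}$ with $H'=t\circ H$. *)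

theory Defs
  imports Complex_Main "HOL-Library.FuncSet" "HOL-Algebra.Group"
begin

section \<open>The category of finite nonempty sets and surjections\<close>

text \<open>
  HOL has no type of all finite sets. The objects are the finite nonempty sets over a universe
  that contains an arbitrary type \<^typ>\<open>'e\<close> (through \<open>Atom\<close>), a designated point for the
  unit object, and is closed under formal pairing, so that cartesian products of objects are
  again objects. The type \<^typ>\<open>'e\<close> is a parameter of everything that follows.
\<close>

datatype 'e point = Star | Atom 'e | Couple "'e point" "'e point"

definition obj :: "'e point set set" where
  "obj = {A. finite A \<and> A \<noteq> {}}"

text \<open>Arrows are extensional functions, so that equality of arrows is equality in HOL.\<close>

definition epi :: "'e point set \<Rightarrow> 'e point set \<Rightarrow> ('e point \<Rightarrow> 'e point) set" where
  "epi A B = {f \<in> A \<rightarrow>\<^sub>E B. f ` A = B}"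

definition ident :: "'e point set \<Rightarrow> 'e point \<Rightarrow> 'e point" where
  "ident A = (\<lambda>x\<in>A. x)"

definition unit_obj :: "'e point set" where
  "unit_obj = {Star}"

definition tensor_obj :: "'e point set \<Rightarrow> 'e point set \<Rightarrow> 'e point set" where
  "tensor_obj A B = {Couple a b | a b. a \<in> A \<and> b \<in> B}"

definition tensor_fun ::
  "'e point set \<Rightarrow> 'e point set \<Rightarrow> ('e point \<Rightarrow> 'e point) \<Rightarrow> ('e point \<Rightarrow> 'e point)
    \<Rightarrow> 'e point \<Rightarrow> 'e point" where
  "tensor_fun P Q f g =
    (\<lambda>z\<in>tensor_obj P Q. case z of Couple p q \<Rightarrow> Couple (f p) (g q) | _ \<Rightarrow> undefined)"


section \<open>Under categories\<close>

text \<open>An object \<open>f : P \<rightarrow> B\<close> of the under category of \<open>P\<close> is the pair \<open>(B, f)\<close>.\<close>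

type_synonym 'e under = "'e point set \<times> ('e point \<Rightarrow> 'e point)"

definition under_obj :: "'e point set \<Rightarrow> 'e under set" where
  "under_obj P = {(B, f). B \<in> obj \<and> f \<in> epi P B}"

definition under_hom :: "'e point set \<Rightarrow> 'e under \<Rightarrow> 'e under \<Rightarrow> ('e point \<Rightarrow> 'e point) set" where
  "under_hom P X X' = {k \<in> epi (fst X) (fst X'). compose P k (snd X) = snd X'}"

definition under_id :: "'e point set \<Rightarrow> 'e under" where
  "under_id P = (P, ident P)"

definition under_unit :: "'e point set \<Rightarrow> 'e under" where
  "under_unit P = (unit_obj, \<lambda>x\<in>P. Star)"

definition under_tensor :: "'e point set \<Rightarrow> 'e under \<Rightarrow> 'e under \<Rightarrow> 'e under" where
  "under_tensor P X Y =
    (let h = (\<lambda>x\<in>P. Couple (snd X x) (snd Y x)) in (h ` P, h))"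

definition under_pullback :: "'e point set \<Rightarrow> 'e under \<Rightarrow> ('e point \<Rightarrow> 'e point) \<Rightarrow> 'e under" where
  "under_pullback P X f = (fst X, compose P (snd X) f)"

definition under_ext_tensor ::
  "'e point set \<Rightarrow> 'e point set \<Rightarrow> 'e under \<Rightarrow> 'e under \<Rightarrow> 'e under" where
  "under_ext_tensor P Q X Y =
    (tensor_obj (fst X) (fst Y), tensor_fun P Q (snd X) (snd Y))"


section \<open>Ordered algebraic structures\<close>

text \<open>
  The underlying monoids are those of \<^theory>\<open>HOL-Algebra.Group\<close>. All of them are thought of
  additively, although the library notation is multiplicative: \<open>x \<otimes> y\<close> is the sum, \<open>\<one>\<close> is zero
  and \<open>x [^] n\<close> is \<open>n\<close> times \<open>x\<close>.
\<close>

record 'w ord_monoid = "'w monoid" +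
  leq :: "'w \<Rightarrow> 'w \<Rightarrow> bool" (infixl \<open>\<preceq>\<index>\<close> 50)

record 'w ord_qvect = "'w ord_monoid" +
  scale :: "rat \<Rightarrow> 'w \<Rightarrow> 'w"

locale ord_comm_monoid =
  comm_monoid W + order: partial_order "\<lparr>carrier = carrier W, eq = (=), le = leq W\<rparr>"
  for W (structure) +
  assumes add_mono:
    "\<lbrakk>x \<in> carrier W; y \<in> carrier W; z \<in> carrier W; w \<in> carrier W; y \<preceq> x; w \<preceq> z\<rbrakk>
      \<Longrightarrow> y \<otimes> w \<preceq> x \<otimes> z"

locale canc_ord_comm_monoid = ord_comm_monoid +
  assumes le_cancel:
    "\<lbrakk>x \<in> carrier W; y \<in> carrier W; z \<in> carrier W; y \<otimes> z \<preceq> x \<otimes> z\<rbrakk> \<Longrightarrow> y \<preceq> x"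

locale ic_ord_comm_monoid = ord_comm_monoid +
  assumes integrally_closed:
    "\<lbrakk>x \<in> carrier W; y \<in> carrier W; a \<in> carrier W; b \<in> carrier W;
      \<And>n::nat. n \<ge> 1 \<Longrightarrow> y [^] n \<otimes> b \<preceq> x [^] n \<otimes> a\<rbrakk> \<Longrightarrow> y \<preceq> x"

locale ord_ab_group = ord_comm_monoid W + comm_group W for W (structure)

locale ic_ord_ab_group = ord_ab_group W + ic_ord_comm_monoid W for W (structure)

locale ord_qvector_space = ord_ab_group W for W (structure) +
  assumes scale_closed: "x \<in> carrier W \<Longrightarrow> scale W a x \<in> carrier W"
    and scale_add_right:
      "\<lbrakk>x \<in> carrier W; y \<in> carrier W\<rbrakk> \<Longrightarrow> scale W a (x \<otimes> y) = scale W a x \<otimes> scale W a y"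
    and scale_add_left:
      "x \<in> carrier W \<Longrightarrow> scale W (a + b) x = scale W a x \<otimes> scale W b x"
    and scale_scale: "x \<in> carrier W \<Longrightarrow> scale W (a * b) x = scale W a (scale W b x)"
    and scale_one: "x \<in> carrier W \<Longrightarrow> scale W 1 x = x"
    and scale_mono:
      "\<lbrakk>x \<in> carrier W; y \<in> carrier W; 0 \<le> a; y \<preceq> x\<rbrakk> \<Longrightarrow> scale W a y \<preceq> scale W a x"

locale ic_ord_qvector_space = ord_qvector_space W + ic_ord_comm_monoid W for W (structure)

text \<open>
  Morphisms are extensional on the carrier, so that uniqueness of a morphism can be expressed
  by equality in HOL.
\<close>

definition ord_hom ::
  "('w, 'm) ord_monoid_scheme \<Rightarrow> ('v, 'n) ord_monoid_scheme \<Rightarrow> ('w \<Rightarrow> 'v) set" where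
  "ord_hom W W' =
    {t \<in> carrier W \<rightarrow>\<^sub>E carrier W'. t \<in> hom W W' \<and> t \<one>\<^bsub>W\<^esub> = \<one>\<^bsub>W'\<^esub> \<and>
      (\<forall>x\<in>carrier W. \<forall>y\<in>carrier W. x \<preceq>\<^bsub>W\<^esub> y \<longrightarrow> t x \<preceq>\<^bsub>W'\<^esub> t y)}"

definition ord_linear_hom ::
  "('w, 'm) ord_qvect_scheme \<Rightarrow> ('v, 'n) ord_qvect_scheme \<Rightarrow> ('w \<Rightarrow> 'v) set" where
  "ord_linear_hom W W' =
    {t \<in> ord_hom W W'. \<forall>a. \<forall>x\<in>carrier W. t (scale W a x) = scale W' a (t x)}"


section \<open>Entropies\<close>

locale entropy =
  fixes W :: "('w, 'm) ord_monoid_scheme" (structure)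
    and h :: "'e point set \<Rightarrow> 'e under \<Rightarrow> 'w"
  assumes closed: "\<lbrakk>P \<in> obj; X \<in> under_obj P\<rbrakk> \<Longrightarrow> h P X \<in> carrier W"
    and monotone:
      "\<lbrakk>P \<in> obj; X \<in> under_obj P; X' \<in> under_obj P; under_hom P X X' \<noteq> {}\<rbrakk>
        \<Longrightarrow> h P X' \<preceq> h P X"
    and subadditive:
      "\<lbrakk>P \<in> obj; X \<in> under_obj P; Y \<in> under_obj P\<rbrakk>
        \<Longrightarrow> h P (under_tensor P X Y) \<preceq> h P X \<otimes> h P Y"
    and unit_nonpos: "P \<in> obj \<Longrightarrow> h P (under_unit P) \<preceq> \<one>"
    and natural:
      "\<lbrakk>P \<in> obj; Q \<in> obj; f \<in> epi P Q; X \<in> under_obj Q\<rbrakk>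
        \<Longrightarrow> h P (under_pullback P X f) = h Q X"
    and additive:
      "\<lbrakk>P \<in> obj; Q \<in> obj; X \<in> under_obj P; Y \<in> under_obj Q\<rbrakk>
        \<Longrightarrow> h (tensor_obj P Q) (under_ext_tensor P Q X Y) = h P X \<otimes> h Q Y"
    and unit_zero: "h unit_obj (under_unit unit_obj) = \<one>"

definition baseless_entropy ::
  "('w, 'm) ord_monoid_scheme \<Rightarrow> ('e point set \<Rightarrow> 'w) \<Rightarrow> bool" where
  "baseless_entropy W H \<longleftrightarrow> (\<exists>h. entropy W h \<and> (\<forall>P\<in>obj. H P = h P (under_id P)))"

text \<open>
  A category of ordered structures is given by a predicate for its objects and by its hom-sets.
  Because arguments of a definition are monomorphic, the predicate is passed twice: \<open>V\<close> is its
  instance at the type of the candidate \<open>W\<close>, and \<open>V'\<close> its instance at the type \<^typ>\<open>'v\<close> over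
  which the competitors \<open>W'\<close> range. As \<^typ>\<open>'v\<close> is free, a theorem about this notion
  quantifies over all competitors of all types.
\<close>

definition universal_baseless_entropy ::
  "(('w, 'm) ord_monoid_scheme \<Rightarrow> bool) \<Rightarrow> (('v, 'n) ord_monoid_scheme \<Rightarrow> bool) \<Rightarrow>
   (('w, 'm) ord_monoid_scheme \<Rightarrow> ('v, 'n) ord_monoid_scheme \<Rightarrow> ('w \<Rightarrow> 'v) set) \<Rightarrow>
   ('w, 'm) ord_monoid_scheme \<Rightarrow> ('e point set \<Rightarrow> 'w) \<Rightarrow> bool" where
  "universal_baseless_entropy V V' Hom W H \<longleftrightarrow>
    V W \<and> baseless_entropy W H \<and>
    (\<forall>W' (H' :: 'e point set \<Rightarrow> 'v). V' W' \<and> baseless_entropy W' H' \<longrightarrow>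
      (\<exists>!t. t \<in> Hom W W' \<and> (\<forall>P\<in>obj. H' P = t (H P))))"


section \<open>The logarithmic codomains\<close>

definition real_ord_monoid :: "real set \<Rightarrow> real ord_monoid" where
  "real_ord_monoid S = \<lparr>carrier = S, mult = (+), one = 0, leq = (\<le>)\<rparr>"

definition log_N :: "real ord_monoid" where
  "log_N = real_ord_monoid {ln (real n) | n. n \<ge> 1}"

definition log_Q :: "real ord_monoid" where
  "log_Q = real_ord_monoid {ln (of_rat q) | q. q > 0}"

definition Q_log_Q :: "real ord_qvect" where
  "Q_log_Q =
    \<lparr>carrier = {of_rat a * ln (of_rat b) | a b. b > 0}, mult = (+), one = 0, leq = (\<le>),
     scale = (\<lambda>a x. of_rat a * x)\<rparr>"

definition log_card :: "'e point set \<Rightarrow> real" where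
  "log_card A = ln (real (card A))"

end

theory Submission
  imports Defs
begin

text \<open>
  An entropy is monotone along surjections and invariant under bijections, so \<open>H A\<close> is a
  function \<open>\<phi>\<close> of \<open>card A\<close>; every positive cardinality occurs, \<open>\<phi>\<close> is monotone, and
  \<open>\<phi> (m * n) = \<phi> m + \<phi> n\<close>. Since \<open>ln\<close> is an order isomorphism from the positive integers
  under multiplication onto \<open>log_N\<close>, such a \<open>\<phi>\<close> is the same as an order-preserving homomorphism
  out of \<open>log_N\<close>. The other two codomains are the ordered group of differences of \<open>log_N\<close> and its
  rational span, to which such homomorphisms extend uniquely when the target is a group or a
  rational vector space.
\<close>

section \<open>Ordered monoids\<close>

context ord_comm_monoid
begin

lemma leq_refl: "x \<in> carrier W \<Longrightarrow> x \<preceq> x"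
  using order.le_refl[of x] by simp

lemma leq_antisym: "\<lbrakk>x \<preceq> y; y \<preceq> x; x \<in> carrier W; y \<in> carrier W\<rbrakk> \<Longrightarrow> x = y"
  using order.le_antisym[of x y] by simp

end

text \<open>Adding \<open>inv b \<otimes> inv d\<close> to both sides and regrouping cancels
  \<open>d\<close> on the left and \<open>b\<close> on the right. Differences can thus be compared
  through an inequality free of inverses.\<close>

lemma (in ord_ab_group) leq_diff:
  assumes "a \<in> carrier W" "b \<in> carrier W" "c \<in> carrier W" "d \<in> carrier W"
    and "a \<otimes> d \<preceq> c \<otimes> b"
  shows "a \<otimes> inv b \<preceq> c \<otimes> inv d"
proof -
  have "(a \<otimes> d) \<otimes> (inv b \<otimes> inv d) \<preceq> (c \<otimes> b) \<otimes> (inv b \<otimes> inv d)"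
    using assms by (intro add_mono[of _ _ _ "inv b \<otimes> inv d"] leq_refl) auto
  moreover have "(a \<otimes> d) \<otimes> (inv b \<otimes> inv d) = (a \<otimes> inv b) \<otimes> (d \<otimes> inv d)"
    using assms(1-4) by (simp only: m_ac m_closed inv_closed)
  moreover have "(c \<otimes> b) \<otimes> (inv b \<otimes> inv d) = (c \<otimes> inv d) \<otimes> (b \<otimes> inv b)"
    using assms(1-4) by (simp only: m_ac m_closed inv_closed)
  ultimately show ?thesis
    using assms(1-4) by simp
qed

lemma
  assumes "t \<in> ord_hom A W"
  shows ord_hom_closed: "x \<in> carrier A \<Longrightarrow> t x \<in> carrier W"
    and ord_hom_mult: "\<lbrakk>x \<in> carrier A; y \<in> carrier A\<rbrakk> \<Longrightarrow> t (x \<otimes>\<^bsub>A\<^esub> y) = t x \<otimes>\<^bsub>W\<^esub> t y"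
    and ord_hom_one: "t \<one>\<^bsub>A\<^esub> = \<one>\<^bsub>W\<^esub>"
    and ord_hom_mono: "\<lbrakk>x \<in> carrier A; y \<in> carrier A; x \<preceq>\<^bsub>A\<^esub> y\<rbrakk> \<Longrightarrow> t x \<preceq>\<^bsub>W\<^esub> t y"
    and ord_hom_extensional: "t \<in> extensional (carrier A)"
  using assms by (auto simp: ord_hom_def hom_def PiE_def)


section \<open>Additive submonoids of the reals\<close>

text \<open>The operations are fixed by equations over an arbitrary record extension, so that
  \<open>Q_log_Q\<close> with its \<open>scale\<close> field is an instance alongside
  \<open>log_N\<close> and \<open>log_Q\<close>.\<close>

locale real_submonoid =
  fixes A :: "(real, 'm) ord_monoid_scheme" (structure)
  assumes mult_eq: "mult A = (+)" and one_eq: "one A = 0" and leq_eq: "leq A = (\<le>)"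
    and zero_mem: "0 \<in> carrier A"
    and add_mem: "\<lbrakk>x \<in> carrier A; y \<in> carrier A\<rbrakk> \<Longrightarrow> x + y \<in> carrier A"

sublocale real_submonoid \<subseteq> canc_ord_comm_monoid A
  by unfold_locales (auto simp: mult_eq one_eq leq_eq zero_mem add_mem)

context real_submonoid
begin

lemma nat_pow_eq: "x [^] (n::nat) = real n * x"
  by (induction n) (simp_all add: mult_eq one_eq algebra_simps)

lemma of_nat_mult_mem: "x \<in> carrier A \<Longrightarrow> real n * x \<in> carrier A"
  using nat_pow_closed[of x n] by (simp add: nat_pow_eq)

end

text \<open>This is the Archimedean property: if \<open>x < y\<close>, the gap
  \<open>n * (y - x)\<close> eventually exceeds the bounded error \<open>a - b\<close>.\<close>

sublocale real_submonoid \<subseteq> ic_ord_comm_monoid A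
proof
  fix x y a b
  assume *: "\<And>n::nat. n \<ge> 1 \<Longrightarrow> y [^] n \<otimes> b \<preceq> x [^] n \<otimes> a"
  show "y \<preceq> x"
  proof (rule ccontr)
    assume "\<not> y \<preceq> x"
    then have "0 < y - x" by (simp add: leq_eq)
    then obtain n :: nat where n: "\<bar>a - b\<bar> < real n * (y - x)"
      using reals_Archimedean3 by blast
    \<comment> \<open>For \<open>n = 0\<close> the right side would be 0, which cannot strictly
      exceed an absolute value.\<close>
    then have "n \<ge> 1" by (cases n) auto
    from *[OF this] n show False
      by (simp add: leq_eq mult_eq nat_pow_eq algebra_simps)
  qed
qed

locale real_subgroup = real_submonoid A for A (structure) +
  assumes uminus_mem: "x \<in> carrier A \<Longrightarrow> - x \<in> carrier A"

sublocale real_subgroup \<subseteq> ic_ord_ab_group A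
proof
  show "carrier A \<subseteq> Units A"
    by (auto simp: Units_def mult_eq one_eq intro!: bexI[of _ "- x" for x] uminus_mem)
qed

section \<open>Order-preserving homomorphisms out of additive submonoids of the reals\<close>

context real_submonoid
begin

text \<open>A monotone relation is functional, by antisymmetry of the target.\<close>

lemma ord_hom_of_relation:
  fixes W :: "('w, 'n) ord_monoid_scheme" and R :: "real \<Rightarrow> 'w \<Rightarrow> bool"
  assumes W: "ord_comm_monoid W"
    and total: "\<And>x. x \<in> carrier A \<Longrightarrow> \<exists>w. R x w"
    and closed: "\<And>x w. R x w \<Longrightarrow> w \<in> carrier W"
    and mono: "\<And>x y v w. \<lbrakk>R x v; R y w; x \<le> y\<rbrakk> \<Longrightarrow> v \<preceq>\<^bsub>W\<^esub> w"
    and add: "\<And>x y v w. \<lbrakk>R x v; R y w\<rbrakk> \<Longrightarrow> R (x + y) (v \<otimes>\<^bsub>W\<^esub> w)"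
    and zero: "R 0 \<one>\<^bsub>W\<^esub>"
  obtains t where "t \<in> ord_hom A W" and "\<And>x w. \<lbrakk>x \<in> carrier A; R x w\<rbrakk> \<Longrightarrow> t x = w"
proof
  interpret W: ord_comm_monoid W by (fact W)
  define t where "t = (\<lambda>x\<in>carrier A. SOME w. R x w)"
  have R: "R x (t x)" if "x \<in> carrier A" for x
    using total[OF that] that by (simp add: t_def someI_ex)
  show eq: "t x = w" if "x \<in> carrier A" "R x w" for x w
    using R[OF that(1)] that(2) by (intro W.leq_antisym mono[of x _ x] closed[of x]) auto
  show "t \<in> ord_hom A W"
    unfolding ord_hom_def hom_def mult_eq one_eq leq_eq
  proof (intro CollectI conjI ballI impI)
    show "t \<in> carrier A \<rightarrow>\<^sub>E carrier W" "t \<in> carrier A \<rightarrow> carrier W"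
      using R closed by (auto simp: t_def)
    show "t (x + y) = t x \<otimes>\<^bsub>W\<^esub> t y" if "x \<in> carrier A" "y \<in> carrier A" for x y
      using that by (intro eq add R add_mem)
    show "t 0 = \<one>\<^bsub>W\<^esub>"
      by (intro eq zero zero_mem)
    show "t x \<preceq>\<^bsub>W\<^esub> t y" if "x \<in> carrier A" "y \<in> carrier A" "x \<le> y" for x y
      using that by (intro mono[of x _ y] R)
  qed
qed

text \<open>Serves uniqueness: a morphism out of a larger codomain becomes comparable with the
  universal morphism out of a smaller one. \<open>restrict\<close> keeps it extensional.\<close>

lemma ord_hom_restrict:
  assumes "real_submonoid B" "carrier A \<subseteq> carrier B" "t \<in> ord_hom B W"
  shows "restrict t (carrier A) \<in> ord_hom A W"
proof -
  interpret B: real_submonoid B by fact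
  show ?thesis
    using ord_hom_closed[OF assms(3)] ord_hom_mult[OF assms(3)] ord_hom_one[OF assms(3)]
      ord_hom_mono[OF assms(3)] assms(2) zero_mem add_mem
    unfolding ord_hom_def hom_def mult_eq one_eq leq_eq B.mult_eq B.one_eq B.leq_eq
    by (auto simp: subset_iff)
qed

lemma ord_hom_add:
  "\<lbrakk>t \<in> ord_hom A W; x \<in> carrier A; y \<in> carrier A\<rbrakk> \<Longrightarrow> t (x + y) = t x \<otimes>\<^bsub>W\<^esub> t y"
  using ord_hom_mult[of t A W x y] by (simp add: mult_eq)

lemma ord_hom_zero: "t \<in> ord_hom A W \<Longrightarrow> t 0 = \<one>\<^bsub>W\<^esub>"
  using ord_hom_one[of t A W] by (simp add: one_eq)

lemma ord_hom_le:
  "\<lbrakk>t \<in> ord_hom A W; x \<in> carrier A; y \<in> carrier A; x \<le> y\<rbrakk> \<Longrightarrow> t x \<preceq>\<^bsub>W\<^esub> t y"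
  using ord_hom_mono[of t A W x y] by (simp add: leq_eq)

text \<open>The extension must send \<open>x - y\<close> to \<open>s x\<close> minus
  \<open>s y\<close>. This is well defined and monotone because an inequality between differences in
  the reals is equivalent to one between sums, which already lives in \<open>A\<close>.\<close>

lemma ord_hom_extend_differences:
  fixes W :: "('w, 'n) ord_monoid_scheme"
  assumes B: "real_submonoid B" and W: "ord_ab_group W" and s: "s \<in> ord_hom A W"
    and carrier_B: "carrier B = {x - y | x y. x \<in> carrier A \<and> y \<in> carrier A}"
  shows "\<exists>!t. t \<in> ord_hom B W \<and> (\<forall>x\<in>carrier A. t x = s x)"
proof -
  interpret B: real_submonoid B by (fact B)
  interpret W: ord_ab_group W by (fact W)
  have s_closed [simp]: "s x \<in> carrier W" if "x \<in> carrier A" for x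
    using ord_hom_closed[OF s that] .
  \<comment> \<open>The graph of the forced extension, over all ways to write \<open>z\<close> as a
    difference; its independence of that choice will follow from its monotonicity.\<close>
  define R where "R = (\<lambda>z w. \<exists>x\<in>carrier A. \<exists>y\<in>carrier A.
    z = x - y \<and> w = s x \<otimes>\<^bsub>W\<^esub> inv\<^bsub>W\<^esub> s y)"
  obtain t where t: "t \<in> ord_hom B W" "\<And>z w. \<lbrakk>z \<in> carrier B; R z w\<rbrakk> \<Longrightarrow> t z = w"
  proof (rule B.ord_hom_of_relation[of W R])
    show "ord_comm_monoid W" by unfold_locales
    show "\<exists>w. R z w" if "z \<in> carrier B" for z
      using that by (auto simp: R_def carrier_B)
    show "w \<in> carrier W" if "R z w" for z w
      using that by (auto simp: R_def)
    show "v \<preceq>\<^bsub>W\<^esub> w" if v: "R z v" and w: "R z' w" and "z \<le> z'" for z z' v w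
    proof -
      obtain x y where xy: "x \<in> carrier A" "y \<in> carrier A" "z = x - y" "v = s x \<otimes>\<^bsub>W\<^esub> inv\<^bsub>W\<^esub> s y"
        using v by (auto simp: R_def)
      obtain x' y' where xy': "x' \<in> carrier A" "y' \<in> carrier A" "z' = x' - y'"
          "w = s x' \<otimes>\<^bsub>W\<^esub> inv\<^bsub>W\<^esub> s y'"
        using w by (auto simp: R_def)
      \<comment> \<open>Clearing the subtractions in \<open>z \<le> z'\<close> gives an inequality
        between elements of \<open>A\<close>, where \<open>s\<close> is monotone.\<close>
      have "s (x + y') \<preceq>\<^bsub>W\<^esub> s (x' + y)"
        using xy xy' \<open>z \<le> z'\<close> by (intro ord_hom_le[OF s] add_mem) auto
      then show ?thesis
        using xy xy' by (auto simp: ord_hom_add[OF s] intro: W.leq_diff)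
    qed
    show "R (z + z') (v \<otimes>\<^bsub>W\<^esub> w)" if v: "R z v" and w: "R z' w" for z z' v w
    proof -
      obtain x y where xy: "x \<in> carrier A" "y \<in> carrier A" "z = x - y" "v = s x \<otimes>\<^bsub>W\<^esub> inv\<^bsub>W\<^esub> s y"
        using v by (auto simp: R_def)
      obtain x' y' where xy': "x' \<in> carrier A" "y' \<in> carrier A" "z' = x' - y'"
          "w = s x' \<otimes>\<^bsub>W\<^esub> inv\<^bsub>W\<^esub> s y'"
        using w by (auto simp: R_def)
      have "v \<otimes>\<^bsub>W\<^esub> w = s (x + x') \<otimes>\<^bsub>W\<^esub> inv\<^bsub>W\<^esub> s (y + y')"
        using xy xy' by (simp add: ord_hom_add[OF s] W.inv_mult W.m_ac)
      moreover have "z + z' = (x + x') - (y + y')"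
        using xy xy' by simp
      ultimately show ?thesis
        using xy xy' add_mem unfolding R_def by blast
    qed
    show "R 0 \<one>\<^bsub>W\<^esub>"
      unfolding R_def
      by (intro bexI[of _ 0]) (auto simp: zero_mem ord_hom_zero[OF s])
  qed blast
  have ts: "t x = s x" if "x \<in> carrier A" for x
  proof (rule t(2))
    show "R x (s x)"
      unfolding R_def using that
      by (intro bexI[of _ x] bexI[of _ 0]) (auto simp: zero_mem ord_hom_zero[OF s])
    then show "x \<in> carrier B"
      by (auto simp: R_def carrier_B)
  qed
  have sub: "x \<in> carrier B" if "x \<in> carrier A" for x
    using that zero_mem diff_zero[of x, symmetric] unfolding carrier_B by blast
  show ?thesis
  proof (rule ex1I[of _ t])
    fix u assume u: "u \<in> ord_hom B W \<and> (\<forall>x\<in>carrier A. u x = s x)"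
    show "u = t"
    proof (rule extensionalityI[of _ "carrier B"])
      fix z assume z: "z \<in> carrier B"
      then obtain x y where xy: "x \<in> carrier A" "y \<in> carrier A" "z = x - y"
        by (auto simp: carrier_B)
      \<comment> \<open>Since \<open>z + y = x\<close>, both sides equal \<open>s x\<close>;
        cancelling \<open>s y\<close> in the group then gives \<open>u z = t z\<close>.\<close>
      have "u z \<otimes>\<^bsub>W\<^esub> s y = t z \<otimes>\<^bsub>W\<^esub> s y"
        using B.ord_hom_add[of u W z y] B.ord_hom_add[OF t(1) z sub[OF xy(2)]] u xy z
          sub[OF xy(2)] ts[OF xy(1)] ts[OF xy(2)] by simp
      moreover have "u z \<in> carrier W" "t z \<in> carrier W"
        using u t(1) by (simp_all add: ord_hom_closed[OF _ z])
      ultimately show "u z = t z"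
        using xy(2) by simp
    qed (use u t(1) in \<open>auto intro: ord_hom_extensional\<close>)
  qed (use t(1) ts in auto)
qed

end


section \<open>Rational spans\<close>

context ord_qvector_space
begin

lemma scale_zero_left: "x \<in> carrier W \<Longrightarrow> scale W 0 x = \<one>"
  using scale_add_left[of x 0 0] scale_closed[of x 0] by (simp add: l_cancel_one')

lemma scale_minus: "x \<in> carrier W \<Longrightarrow> scale W (- a) x = inv (scale W a x)"
  using scale_add_left[of x "- a" a]
  by (intro inv_equality[symmetric]) (simp_all add: scale_zero_left scale_closed)

end

context real_subgroup
begin

lemma of_int_mult_mem: "x \<in> carrier A \<Longrightarrow> of_int k * x \<in> carrier A"
  by (cases k rule: int_cases2) (auto intro: of_nat_mult_mem uminus_mem)

text \<open>Additivity gives nonnegative multiples by induction and negative ones through inverses.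
  \<open>A\<close> itself carries no scalars, so this is the link between multiples in
  \<open>A\<close> and scalars in \<open>W\<close>.\<close>

lemma ord_hom_of_int_mult:
  assumes W: "ord_qvector_space W" and s: "s \<in> ord_hom A W" and x: "x \<in> carrier A"
  shows "s (of_int k * x) = scale W (of_int k) (s x)"
proof -
  interpret W: ord_qvector_space W by (fact W)
  have sx: "s x \<in> carrier W" by (rule ord_hom_closed[OF s x])
  have nat: "s (real n * x) = scale W (of_nat n) (s x)" for n
  proof (induction n)
    case (Suc n)
    then show ?case
      using ord_hom_add[OF s x of_nat_mult_mem[OF x, of n]] sx
      by (simp add: algebra_simps W.scale_add_left W.scale_one)
  qed (simp add: ord_hom_zero[OF s] W.scale_zero_left sx)
  show ?thesis
  proof (cases k rule: int_cases2)
    case (nonneg n)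
    then show ?thesis using nat by simp
  next
    case (nonpos n)
    have mem: "- (real n * x) \<in> carrier A" "real n * x \<in> carrier A"
      using of_nat_mult_mem[OF x] uminus_mem by auto
    have "s (- (real n * x)) \<otimes>\<^bsub>W\<^esub> s (real n * x) = \<one>\<^bsub>W\<^esub>"
      using ord_hom_add[OF s mem] by (simp add: ord_hom_zero[OF s])
    then have "s (- (real n * x)) = inv\<^bsub>W\<^esub> s (real n * x)"
      using mem ord_hom_closed[OF s] by (intro W.inv_equality[symmetric]) auto
    then show ?thesis
      using nonpos nat by (simp add: W.scale_minus sx)
  qed
qed

text \<open>Linearity forces \<open>x / n\<close> to go to \<open>1 / n\<close> times
  \<open>s x\<close>. Any two fractions have a common denominator, over which order and addition
  reduce to those of the numerators in \<open>A\<close>.\<close>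

lemma ord_hom_extend_rational_span:
  fixes W :: "('w, 'n) ord_qvect_scheme" and B :: "(real, 'k) ord_qvect_scheme"
  assumes B: "real_submonoid B" and scale_B: "\<And>a x. scale B a x = of_rat a * x"
    and W: "ord_qvector_space W" and s: "s \<in> ord_hom A W"
    and carrier_B: "carrier B = {x / real n | x n. x \<in> carrier A \<and> n \<ge> 1}"
  shows "\<exists>!t. t \<in> ord_linear_hom B W \<and> (\<forall>x\<in>carrier A. t x = s x)"
proof -
  interpret B: real_submonoid B by (fact B)
  interpret W: ord_qvector_space W by (fact W)
  have s_closed [simp]: "s x \<in> carrier W" if "x \<in> carrier A" for x
    using ord_hom_closed[OF s that] .
  have s_nat: "s (real n * x) = scale W (of_nat n) (s x)" if "x \<in> carrier A" for x n
    using ord_hom_of_int_mult[OF W s that, of "int n"] by simp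
  define R where "R = (\<lambda>z w. \<exists>x\<in>carrier A. \<exists>n\<ge>1.
    z = x / real n \<and> w = scale W (1 / of_nat n) (s x))"
  \<comment> \<open>Expanding a fraction by \<open>m\<close> leaves its prescribed value unchanged,
    as \<open>s\<close> turns the factor \<open>m\<close> into a scalar that cancels.\<close>
  have scale_cong: "scale W (1 / of_nat n) (s x) = scale W (1 / of_nat (n * m)) (s (real m * x))"
    if "x \<in> carrier A" "m \<ge> 1" "n \<ge> 1" for x m n
    using that by (simp add: s_nat flip: W.scale_scale)
  have common: "\<exists>x\<in>carrier A. \<exists>y\<in>carrier A. \<exists>n\<ge>1. z = x / real n \<and> z' = y / real n \<and>
      v = scale W (1 / of_nat n) (s x) \<and> w = scale W (1 / of_nat n) (s y)"
    if v: "R z v" and w: "R z' w" for z z' v w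
  proof -
    obtain x n where x: "x \<in> carrier A" "n \<ge> 1" "z = x / real n" "v = scale W (1 / of_nat n) (s x)"
      using v by (auto simp: R_def)
    obtain y m where y: "y \<in> carrier A" "m \<ge> 1" "z' = y / real m" "w = scale W (1 / of_nat m) (s y)"
      using w by (auto simp: R_def)
    have "z = (real m * x) / real (n * m)" "z' = (real n * y) / real (n * m)"
      using x y by simp_all
    moreover have "v = scale W (1 / of_nat (n * m)) (s (real m * x))"
      using scale_cong[OF x(1) y(2) x(2)] x by simp
    moreover have "w = scale W (1 / of_nat (n * m)) (s (real n * y))"
      using scale_cong[OF y(1) x(2) y(2)] y by (simp add: mult.commute)
    moreover have "n * m \<ge> 1" using x y by simp
    ultimately show ?thesis
      using of_nat_mult_mem x(1) y(1) by blast
  qed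
  obtain t where t: "t \<in> ord_hom B W" "\<And>z w. \<lbrakk>z \<in> carrier B; R z w\<rbrakk> \<Longrightarrow> t z = w"
  proof (rule B.ord_hom_of_relation[of W R])
    show "ord_comm_monoid W" by unfold_locales
    show "\<exists>w. R z w" if "z \<in> carrier B" for z
      using that by (auto simp: R_def carrier_B)
    show "w \<in> carrier W" if "R z w" for z w
      using that by (auto simp: R_def W.scale_closed)
    show "v \<preceq>\<^bsub>W\<^esub> w" if v: "R z v" and w: "R z' w" and "z \<le> z'" for z z' v w
      using common[OF v w] \<open>z \<le> z'\<close>
      by (auto simp: divide_le_cancel intro!: W.scale_mono ord_hom_le[OF s])
    show "R (z + z') (v \<otimes>\<^bsub>W\<^esub> w)" if v: "R z v" and w: "R z' w" for z z' v w
    proof -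
      obtain x y n where *: "x \<in> carrier A" "y \<in> carrier A" "n \<ge> 1" "z = x / real n" "z' = y / real n"
          "v = scale W (1 / of_nat n) (s x)" "w = scale W (1 / of_nat n) (s y)"
        using common[OF v w] by blast
      have "z + z' = (x + y) / real n" "v \<otimes>\<^bsub>W\<^esub> w = scale W (1 / of_nat n) (s (x + y))"
        using * by (simp_all add: add_divide_distrib ord_hom_add[OF s] W.scale_add_right)
      with * show ?thesis
        unfolding R_def using add_mem by blast
    qed
    have "scale W 1 (s 0) = \<one>\<^bsub>W\<^esub>"
      using zero_mem by (simp add: W.scale_one ord_hom_zero[OF s])
    then show "R 0 \<one>\<^bsub>W\<^esub>"
      unfolding R_def using zero_mem
      by (intro bexI[of _ 0] exI[of _ "1::nat"]) auto
  qed blast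
  have sub: "x \<in> carrier B" if "x \<in> carrier A" for x
    using that by (auto simp: carrier_B intro!: exI[of _ x] exI[of _ "1::nat"])
  have ts: "t x = s x" if "x \<in> carrier A" for x
    using that sub unfolding R_def
    by (intro t(2)) (auto intro!: bexI[of _ x] exI[of _ "1::nat"] simp: R_def W.scale_one)
  \<comment> \<open>With \<open>a = p / q\<close> and \<open>z = x / n\<close>, the product is
    \<open>p * x\<close> over \<open>q * n\<close>. The numerator stays in \<open>A\<close>, and
    \<open>s\<close> lets the integer \<open>p\<close> out as a scalar.\<close>
  have scale: "of_rat a * z \<in> carrier B \<and> t (of_rat a * z) = scale W a (t z)"
    if z: "z \<in> carrier B" for a z
  proof -
    obtain x n where x: "x \<in> carrier A" "n \<ge> 1" "z = x / real n"
      using z by (auto simp: carrier_B)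
    obtain p q where pq: "a = of_int p / of_nat q" "q \<ge> 1"
    proof -
      obtain p q where "quotient_of a = (p, q)" by force
      then have "a = of_int p / of_nat (nat q)" "nat q \<ge> 1"
        using quotient_of_div[of a p q] quotient_of_denom_pos[of a p q] by auto
      then show ?thesis using that by blast
    qed
    have px: "of_int p * x \<in> carrier A" by (rule of_int_mult_mem[OF x(1)])
    have az: "of_rat a * z = (of_int p * x) / real (q * n)"
      using x pq by (simp add: of_rat_divide)
    have qn: "q * n \<ge> 1" using x pq by simp
    have mem: "of_rat a * z \<in> carrier B"
      unfolding carrier_B using az px qn by blast
    have tz: "t z = scale W (1 / of_nat n) (s x)"
      using x by (intro t(2)[OF z]) (auto simp: R_def)
    have "t (of_rat a * z) = scale W (1 / of_nat (q * n)) (s (of_int p * x))"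
      using az px qn unfolding R_def by (intro t(2)[OF mem, unfolded R_def]) blast
    also have "\<dots> = scale W (1 / of_nat (q * n) * of_int p) (s x)"
      using x W.scale_scale[of "s x" "1 / of_nat (q * n)" "of_int p"]
      by (simp add: ord_hom_of_int_mult[OF W s])
    also have "\<dots> = scale W (a * (1 / of_nat n)) (s x)"
      by (simp add: pq(1))
    also have "\<dots> = scale W a (t z)"
      unfolding tz using x by (intro W.scale_scale) simp
    finally show ?thesis using mem by simp
  qed
  show ?thesis
  proof (rule ex1I[of _ t])
    show "t \<in> ord_linear_hom B W \<and> (\<forall>x\<in>carrier A. t x = s x)"
      using t(1) ts scale by (auto simp: ord_linear_hom_def scale_B)
    fix u assume u: "u \<in> ord_linear_hom B W \<and> (\<forall>x\<in>carrier A. u x = s x)"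
    then have u_hom: "u \<in> ord_hom B W" by (simp add: ord_linear_hom_def)
    show "u = t"
    proof (rule extensionalityI[of _ "carrier B"])
      fix z assume z: "z \<in> carrier B"
      then obtain x n where x: "x \<in> carrier A" "n \<ge> 1" "z = x / real n"
        by (auto simp: carrier_B)
      \<comment> \<open>Exhibits \<open>z\<close> as a scalar multiple of an element of
        \<open>A\<close>, where linear maps that agree on \<open>A\<close> must agree.\<close>
      have "z = of_rat (1 / of_nat n) * x"
        using x by (simp add: of_rat_divide)
      then show "u z = t z"
        using u x sub ts scale[OF sub[OF x(1)], of "1 / of_nat n"]
        by (auto simp: ord_linear_hom_def scale_B)
    qed (use u_hom t(1) in \<open>auto intro: ord_hom_extensional\<close>)
  qed
qed

end


section \<open>Baseless entropies\<close>

text \<open>Pairing with \<open>Star\<close> is injective but never hits \<open>Star\<close>, which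
  is impossible on a finite type. This holds for every \<open>'e\<close>, finite ones
  included.\<close>

lemma infinite_UNIV_point: "infinite (UNIV :: 'e point set)"
proof
  assume "finite (UNIV :: 'e point set)"
  then have "surj (Couple Star :: 'e point \<Rightarrow> 'e point)"
    by (rule finite_UNIV_inj_surj) (simp add: inj_def)
  then show False
    by (metis point.distinct(3) surj_def)
qed

text \<open>Serves twice: it supplies a representative for every positive integer, and it makes
  \<open>log_card\<close> surjective onto \<open>log_N\<close>, whence uniqueness.\<close>

lemma ex_obj_card:
  assumes "n \<ge> 1"
  obtains P :: "'e point set" where "P \<in> obj" "card P = n"
  using infinite_arbitrarily_large[OF infinite_UNIV_point, of n] assms
  by (force simp: obj_def)

lemma obj_card_ge_1: "P \<in> obj \<Longrightarrow> card P \<ge> 1"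
  by (simp add: obj_def Suc_le_eq card_gt_0_iff)

lemma tensor_obj_eq_image: "tensor_obj P Q = (\<lambda>(p, q). Couple p q) ` (P \<times> Q)"
  by (auto simp: tensor_obj_def)

lemma card_tensor_obj: "card (tensor_obj P Q) = card P * card Q"
  unfolding tensor_obj_eq_image
  by (subst card_image) (auto simp: inj_on_def card_cartesian_product)

lemma tensor_obj_mem: "\<lbrakk>P \<in> obj; Q \<in> obj\<rbrakk> \<Longrightarrow> tensor_obj P Q \<in> obj"
  by (auto simp: obj_def tensor_obj_eq_image)

lemma unit_obj_mem: "unit_obj \<in> obj"
  by (simp add: obj_def unit_obj_def)

lemma under_id_mem: "P \<in> obj \<Longrightarrow> under_id P \<in> under_obj P"
  by (auto simp: under_id_def under_obj_def epi_def ident_def)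

text \<open>An injection of \<open>Q\<close> into \<open>P\<close> is inverted on its image, and the
  remaining points of \<open>P\<close> go to one fixed \<open>q\<close>, available because
  \<open>Q\<close> is nonempty.\<close>

lemma ex_epi:
  assumes "P \<in> obj" "Q \<in> obj" "card Q \<le> card P"
  shows "epi P Q \<noteq> {}"
proof -
  obtain g where g: "g ` Q \<subseteq> P" "inj_on g Q"
    using assms by (metis card_le_inj obj_def mem_Collect_eq)
  obtain q where "q \<in> Q" using assms by (auto simp: obj_def)
  define f where "f = (\<lambda>x\<in>P. if x \<in> g ` Q then inv_into Q g x else q)"
  have "f ` P = Q"
  proof
    show "f ` P \<subseteq> Q"
      using \<open>q \<in> Q\<close> g by (auto simp: f_def)
    show "Q \<subseteq> f ` P"
    proof
      fix y assume "y \<in> Q"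
      then have "f (g y) = y" "g y \<in> P"
        using g by (auto simp: f_def)
      then show "y \<in> f ` P" by (metis imageI)
    qed
  qed
  moreover have "f \<in> extensional P" by (simp add: f_def)
  ultimately have "f \<in> epi P Q" by (auto simp: epi_def PiE_def)
  then show ?thesis by blast
qed

section \<open>Values of an entropy at identities\<close>

context entropy
begin

text \<open>Naturality applied to the identity of \<open>Q\<close>, whose pullback along
  \<open>f\<close> is \<open>f\<close> itself.\<close>

lemma id_eq_of_epi:
  assumes "P \<in> obj" "Q \<in> obj" "f \<in> epi P Q"
  shows "h P (Q, f) = h Q (under_id Q)"
proof -
  have "under_pullback P (under_id Q) f = (Q, f)"
    using assms(3) by (auto simp: under_pullback_def under_id_def ident_def epi_def compose_def
        PiE_def extensional_def fun_eq_iff)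
  then show ?thesis
    using natural[OF assms under_id_mem[OF assms(2)]] by simp
qed

text \<open>A surjection \<open>f\<close> from \<open>P\<close> onto \<open>Q\<close> is itself a
  morphism from the identity of \<open>P\<close> to \<open>(Q, f)\<close> in the under category, and
  \<open>(Q, f)\<close> has the value of the identity of \<open>Q\<close>.\<close>

lemma id_mono:
  assumes "P \<in> obj" "Q \<in> obj" "card Q \<le> card P"
  shows "h Q (under_id Q) \<preceq> h P (under_id P)"
proof -
  obtain f where f: "f \<in> epi P Q" using ex_epi[OF assms] by blast
  then have "f \<in> under_hom P (under_id P) (Q, f)"
    by (auto simp: under_hom_def under_id_def ident_def epi_def compose_def
        PiE_def extensional_def fun_eq_iff)
  moreover have "(Q, f) \<in> under_obj P"
    using assms f by (simp add: under_obj_def)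
  ultimately have "h P (Q, f) \<preceq> h P (under_id P)"
    using assms by (intro monotone under_id_mem) auto
  then show ?thesis
    by (simp add: id_eq_of_epi[OF assms(1,2) f])
qed

lemma id_tensor:
  assumes "P \<in> obj" "Q \<in> obj"
  shows "h (tensor_obj P Q) (under_id (tensor_obj P Q)) = h P (under_id P) \<otimes> h Q (under_id Q)"
proof -
  have "under_ext_tensor P Q (under_id P) (under_id Q) = under_id (tensor_obj P Q)"
    by (auto simp: under_ext_tensor_def under_id_def tensor_fun_def tensor_obj_def ident_def
        fun_eq_iff)
  then show ?thesis
    using additive[OF assms under_id_mem under_id_mem] assms by simp
qed

lemma id_unit: "h unit_obj (under_id unit_obj) = \<one>"
proof -
  have "under_unit unit_obj = (under_id unit_obj :: 'c under)"
    by (auto simp: under_unit_def under_id_def ident_def unit_obj_def fun_eq_iff)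
  then show ?thesis using unit_zero by metis
qed

end

text \<open>Between objects of equal cardinality monotonicity holds in both directions, so
  antisymmetry identifies their values. Hence \<open>\<phi>\<close> may be read off from one
  representative per cardinality.\<close>

lemma baseless_entropy_obtains_card:
  fixes H :: "'e point set \<Rightarrow> 'w"
  assumes W: "ord_comm_monoid W" and H: "baseless_entropy W H"
  obtains \<phi> :: "nat \<Rightarrow> 'w" where "\<And>P. P \<in> obj \<Longrightarrow> H P = \<phi> (card P)"
    and "\<And>n. n \<ge> 1 \<Longrightarrow> \<phi> n \<in> carrier W"
    and "\<And>m n. \<lbrakk>m \<ge> 1; m \<le> n\<rbrakk> \<Longrightarrow> \<phi> m \<preceq>\<^bsub>W\<^esub> \<phi> n"
    and "\<And>m n. \<lbrakk>m \<ge> 1; n \<ge> 1\<rbrakk> \<Longrightarrow> \<phi> (m * n) = \<phi> m \<otimes>\<^bsub>W\<^esub> \<phi> n"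
    and "\<phi> 1 = \<one>\<^bsub>W\<^esub>"
proof -
  interpret W: ord_comm_monoid W by (fact W)
  obtain h where "entropy W h" and hH: "\<And>P. P \<in> obj \<Longrightarrow> H P = h P (under_id P)"
    using H by (auto simp: baseless_entropy_def)
  then interpret entropy W h by simp
  \<comment> \<open>At \<open>n = 0\<close> the choice is arbitrary, as objects are nonempty; hence
    the guards \<open>n \<ge> 1\<close>.\<close>
  define P where "P = (\<lambda>n. SOME P :: 'e point set. P \<in> obj \<and> card P = n)"
  have P: "P n \<in> obj \<and> card (P n) = n" if "n \<ge> 1" for n
  proof -
    have "\<exists>P :: 'e point set. P \<in> obj \<and> card P = n"
      using ex_obj_card[OF that] by metis
    then show ?thesis unfolding P_def by (rule someI_ex)
  qed
  have closed: "H Q \<in> carrier W" if "Q \<in> obj" for Q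
    using that by (simp add: hH closed under_id_mem)
  have mono: "H Q \<preceq>\<^bsub>W\<^esub> H Q'" if "Q \<in> obj" "Q' \<in> obj" "card Q \<le> card Q'" for Q Q'
    using that by (simp add: hH id_mono)
  have eq: "H Q = H (P n)" if "Q \<in> obj" "card Q = n" for Q n
    using that P[of n] obj_card_ge_1[OF that(1)] by (intro W.leq_antisym mono closed) auto
  show thesis
  proof (rule that[of "\<lambda>n. H (P n)"])
    show "H Q = H (P (card Q))" if "Q \<in> obj" for Q
      using eq that by blast
    show "H (P n) \<in> carrier W" if "n \<ge> 1" for n
      using closed P that by blast
    show "H (P m) \<preceq>\<^bsub>W\<^esub> H (P n)" if "m \<ge> 1" "m \<le> n" for m n
      using P that by (intro mono) auto
    show "H (P (m * n)) = H (P m) \<otimes>\<^bsub>W\<^esub> H (P n)" if "m \<ge> 1" "n \<ge> 1" for m n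
    proof -
      \<comment> \<open>The chosen representative need not be the product, but it has the same
        cardinality.\<close>
      have "H (P (m * n)) = H (tensor_obj (P m) (P n))"
        using P that by (intro eq[symmetric]) (auto simp: tensor_obj_mem card_tensor_obj)
      also have "\<dots> = H (P m) \<otimes>\<^bsub>W\<^esub> H (P n)"
        using P that by (simp add: hH tensor_obj_mem id_tensor)
      finally show ?thesis .
    qed
    have "H (P 1) = H unit_obj"
      using unit_obj_mem by (intro eq[symmetric]) (auto simp: unit_obj_def)
    then show "H (P 1) = \<one>\<^bsub>W\<^esub>"
      by (simp add: hH unit_obj_mem id_unit)
  qed
qed

lemma baseless_entropy_closed:
  "\<lbrakk>baseless_entropy W H; P \<in> obj\<rbrakk> \<Longrightarrow> H P \<in> carrier W"
  unfolding baseless_entropy_def using entropy.closed under_id_mem by metis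

text \<open>The entropy of \<open>X\<close> is the logarithm of the size of its codomain:
  surjections do not increase size, and sizes of products multiply. Only membership of the values
  depends on \<open>A\<close>, so one proof serves all three codomains.\<close>

lemma (in real_submonoid) baseless_entropy_log_card:
  assumes ln_mem: "\<And>n::nat. n \<ge> 1 \<Longrightarrow> ln (real n) \<in> carrier A"
  shows "baseless_entropy A (log_card :: 'e point set \<Rightarrow> real)"
proof -
  have ln_mono: "ln (real (card Q)) \<le> ln (real (card P))"
    if "Q \<in> obj" "card Q \<le> card P" for P Q :: "'e point set"
    using that obj_card_ge_1[of Q] by simp
  have "entropy A (\<lambda>P (X :: 'e under). log_card (fst X))"
  proof (unfold_locales, unfold mult_eq one_eq leq_eq log_card_def)
    fix P :: "'e point set" and X :: "'e under"
    assume "P \<in> obj" and X: "X \<in> under_obj P"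
    then show "ln (real (card (fst X))) \<in> carrier A"
      by (intro ln_mem obj_card_ge_1) (auto simp: under_obj_def)
    {
      fix X' assume X': "X' \<in> under_obj P" and "under_hom P X X' \<noteq> {}"
      then obtain k where "k ` fst X = fst X'"
        by (auto simp: under_hom_def epi_def)
      moreover have "finite (fst X)" "fst X' \<in> obj"
        using X X' by (auto simp: under_obj_def obj_def)
      ultimately show "ln (real (card (fst X'))) \<le> ln (real (card (fst X)))"
        by (metis ln_mono card_image_le)
    }
    {
      fix Y assume Y: "Y \<in> under_obj P"
      have obj: "fst X \<in> obj" "fst Y \<in> obj"
        using X Y by (auto simp: under_obj_def)
      \<comment> \<open>Subadditivity comes from here: the image of the joint map lies in the full
        product of the codomains.\<close>
      have "fst (under_tensor P X Y) \<subseteq> tensor_obj (fst X) (fst Y)"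
        using X Y by (auto simp: under_tensor_def Let_def tensor_obj_def under_obj_def epi_def)
      moreover have "fst (under_tensor P X Y) \<in> obj"
        using \<open>P \<in> obj\<close> by (auto simp: under_tensor_def Let_def obj_def)
      ultimately have "ln (real (card (fst (under_tensor P X Y))))
          \<le> ln (real (card (tensor_obj (fst X) (fst Y))))"
        using tensor_obj_mem[OF obj] by (intro ln_mono card_mono) (auto simp: obj_def)
      then show "ln (real (card (fst (under_tensor P X Y))))
          \<le> ln (real (card (fst X))) + ln (real (card (fst Y)))"
        using obj_card_ge_1[OF obj(1)] obj_card_ge_1[OF obj(2)]
        by (simp add: card_tensor_obj ln_mult)
    }
    {
      fix Q :: "'e point set" and Y assume "Y \<in> under_obj Q"
      then have obj: "fst X \<in> obj" "fst Y \<in> obj"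
        using X by (auto simp: under_obj_def)
      show "ln (real (card (fst (under_ext_tensor P Q X Y))))
          = ln (real (card (fst X))) + ln (real (card (fst Y)))"
        using obj_card_ge_1[OF obj(1)] obj_card_ge_1[OF obj(2)]
        by (simp add: under_ext_tensor_def card_tensor_obj ln_mult)
    }
  qed (simp_all add: under_unit_def unit_obj_def under_pullback_def)
  then show ?thesis
    by (auto simp: baseless_entropy_def under_id_def)
qed


section \<open>Universality\<close>

text \<open>Passing to a full subcategory that contains \<open>W\<close> only removes competitors
  and keeps the morphisms.\<close>

lemma universal_baseless_entropy_subcategory:
  assumes "universal_baseless_entropy V V' Hom W H" and "V\<^sub>2 W" and "\<And>W'. V\<^sub>2' W' \<Longrightarrow> V' W'"
  shows "universal_baseless_entropy V\<^sub>2 V\<^sub>2' Hom W H"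
  using assms unfolding universal_baseless_entropy_def by blast

text \<open>Unique extension from \<open>W\<close> to \<open>W\<^sub>2\<close> makes
  \<open>W\<^sub>2\<close> a reflection of \<open>W\<close>. The map out of \<open>W\<^sub>2\<close>
  is the extension of the universal one out of \<open>W\<close>.\<close>

lemma universal_baseless_entropy_reflection:
  fixes H :: "'e point set \<Rightarrow> 'w"
  assumes univ: "universal_baseless_entropy V V' Hom W H"
    and "V\<^sub>2 W\<^sub>2" and "baseless_entropy W\<^sub>2 H" and V: "\<And>W'. V\<^sub>2' W' \<Longrightarrow> V' W'"
    and extend: "\<And>W' s. \<lbrakk>V\<^sub>2' W'; s \<in> Hom W W'\<rbrakk>
      \<Longrightarrow> \<exists>!t. t \<in> Hom\<^sub>2 W\<^sub>2 W' \<and> (\<forall>x\<in>carrier W. t x = s x)"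
    and restr: "\<And>W' t. \<lbrakk>V\<^sub>2' W'; t \<in> Hom\<^sub>2 W\<^sub>2 W'\<rbrakk> \<Longrightarrow> restrict t (carrier W) \<in> Hom W W'"
  shows "universal_baseless_entropy V\<^sub>2 V\<^sub>2' Hom\<^sub>2 W\<^sub>2 H"
  unfolding universal_baseless_entropy_def
proof (intro conjI allI impI)
  show "V\<^sub>2 W\<^sub>2" "baseless_entropy W\<^sub>2 H" by fact+
  fix W' and H' :: "'e point set \<Rightarrow> _"
  assume W': "V\<^sub>2' W' \<and> baseless_entropy W' H'"
  have HW: "H P \<in> carrier W" if "P \<in> obj" for P
    using univ that by (auto simp: universal_baseless_entropy_def intro: baseless_entropy_closed)
  obtain s where s: "s \<in> Hom W W'" "\<forall>P\<in>obj. H' P = s (H P)"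
    and s_unique: "\<And>s'. \<lbrakk>s' \<in> Hom W W'; \<forall>P\<in>obj. H' P = s' (H P)\<rbrakk> \<Longrightarrow> s' = s"
    using univ W' V unfolding universal_baseless_entropy_def by metis
  obtain t where t: "t \<in> Hom\<^sub>2 W\<^sub>2 W'" "\<forall>x\<in>carrier W. t x = s x"
    and t_unique: "\<And>t'. \<lbrakk>t' \<in> Hom\<^sub>2 W\<^sub>2 W'; \<forall>x\<in>carrier W. t' x = s x\<rbrakk> \<Longrightarrow> t' = t"
    using extend[of W' s] W' s by blast
  show "\<exists>!t. t \<in> Hom\<^sub>2 W\<^sub>2 W' \<and> (\<forall>P\<in>obj. H' P = t (H P))"
  proof (rule ex1I[of _ t])
    show "t \<in> Hom\<^sub>2 W\<^sub>2 W' \<and> (\<forall>P\<in>obj. H' P = t (H P))"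
      using s t HW by simp
    fix u assume u: "u \<in> Hom\<^sub>2 W\<^sub>2 W' \<and> (\<forall>P\<in>obj. H' P = u (H P))"
    \<comment> \<open>\<open>H\<close> takes its values in \<open>W\<close>, so the restriction of
      \<open>u\<close> still represents \<open>H'\<close>, and universality of \<open>W\<close>
      identifies it with \<open>s\<close>.\<close>
    then have "restrict u (carrier W) = s"
      using W' HW by (intro s_unique restr) auto
    then have "\<forall>x\<in>carrier W. u x = s x"
      by (metis restrict_apply')
    then show "u = t" using u t_unique by blast
  qed
qed

section \<open>The three logarithmic codomains\<close>

lemma carrier_log_N: "carrier log_N = {ln (real n) | n. n \<ge> 1}"
  by (simp add: log_N_def real_ord_monoid_def)

lemma carrier_log_Q: "carrier log_Q = {ln (of_rat q) | q. q > 0}"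
  by (simp add: log_Q_def real_ord_monoid_def)

lemma carrier_Q_log_Q: "carrier Q_log_Q = {of_rat a * ln (of_rat b) | a b. b > 0}"
  by (simp add: Q_log_Q_def)

text \<open>A positive rational is a quotient of positive integers, and \<open>ln\<close> turns
  quotients into differences.\<close>

lemma log_Q_eq_differences:
  "carrier log_Q = {x - y | x y. x \<in> carrier log_N \<and> y \<in> carrier log_N}"
proof (intro equalityI subsetI)
  fix z assume "z \<in> carrier log_Q"
  then obtain q where q: "q > 0" "z = ln (of_rat q)" by (auto simp: carrier_log_Q)
  obtain a b where "quotient_of q = (a, b)" by force
  then have ab: "q = of_int a / of_int b" "b > 0"
    by (auto intro: quotient_of_div quotient_of_denom_pos)
  then have "a > 0" using q by (simp add: zero_less_divide_iff)
  have "z = ln (real (nat a)) - ln (real (nat b))"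
    using q ab \<open>a > 0\<close> by (simp add: of_rat_divide ln_div)
  moreover have "nat a \<ge> 1" "nat b \<ge> 1" using ab \<open>a > 0\<close> by auto
  ultimately show "z \<in> {x - y | x y. x \<in> carrier log_N \<and> y \<in> carrier log_N}"
    unfolding carrier_log_N by blast
next
  fix z assume "z \<in> {x - y | x y. x \<in> carrier log_N \<and> y \<in> carrier log_N}"
  then obtain m n :: nat where mn: "m \<ge> 1" "n \<ge> 1" "z = ln (real m) - ln (real n)"
    by (auto simp: carrier_log_N)
  then have "z = ln (of_rat (of_nat m / of_nat n))"
    by (simp add: of_rat_divide ln_div)
  then show "z \<in> carrier log_Q"
    using mn by (auto simp: carrier_log_Q intro!: exI[of _ "of_nat m / of_nat n"])
qed

interpretation log_N: real_submonoid log_N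
proof
  show "0 \<in> carrier log_N"
    by (auto simp: carrier_log_N intro!: exI[of _ "1::nat"])
  show "x + y \<in> carrier log_N" if xy: "x \<in> carrier log_N" "y \<in> carrier log_N" for x y
  proof -
    obtain m n :: nat where "m \<ge> 1" "n \<ge> 1" "x = ln (real m)" "y = ln (real n)"
      using xy by (auto simp: carrier_log_N)
    then show ?thesis
      by (auto simp: carrier_log_N ln_mult intro!: exI[of _ "m * n"])
  qed
qed (simp_all add: log_N_def real_ord_monoid_def)

interpretation log_Q: real_subgroup log_Q
proof
  show "0 \<in> carrier log_Q"
    by (auto simp: carrier_log_Q intro!: exI[of _ "1::rat"])
  show "x + y \<in> carrier log_Q" if xy: "x \<in> carrier log_Q" "y \<in> carrier log_Q" for x y
  proof -
    obtain p q where "p > 0" "q > 0" "x = ln (of_rat p)" "y = ln (of_rat q)"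
      using xy by (auto simp: carrier_log_Q)
    then show ?thesis
      by (auto simp: carrier_log_Q of_rat_mult ln_mult intro!: exI[of _ "p * q"])
  qed
  show "- x \<in> carrier log_Q" if "x \<in> carrier log_Q" for x
    using that by (auto simp: log_Q_eq_differences) (metis minus_diff_eq)
qed (simp_all add: log_Q_def real_ord_monoid_def)

text \<open>The numerator of the rational coefficient is absorbed into \<open>log_Q\<close>, which
  is closed under integer multiples, so only a denominator remains.\<close>

lemma Q_log_Q_eq_quotients:
  "carrier Q_log_Q = {x / real n | x n. x \<in> carrier log_Q \<and> n \<ge> 1}"
proof (intro equalityI subsetI)
  fix z assume "z \<in> carrier Q_log_Q"
  then obtain a b where ab: "b > 0" "z = of_rat a * ln (of_rat b)" by (auto simp: carrier_Q_log_Q)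
  obtain p q where "quotient_of a = (p, q)" by force
  then have pq: "a = of_int p / of_int q" "q > 0"
    by (auto intro: quotient_of_div quotient_of_denom_pos)
  then have "z = (of_int p * ln (of_rat b)) / real (nat q)" "nat q \<ge> 1"
    using ab by (auto simp: of_rat_divide)
  moreover have "of_int p * ln (of_rat b) \<in> carrier log_Q"
    using ab by (intro log_Q.of_int_mult_mem) (auto simp: carrier_log_Q)
  ultimately show "z \<in> {x / real n | x n. x \<in> carrier log_Q \<and> n \<ge> 1}"
    by blast
next
  fix z assume "z \<in> {x / real n | x n. x \<in> carrier log_Q \<and> n \<ge> 1}"
  then obtain q n where "q > 0" "n \<ge> 1" "z = ln (of_rat q) / real n"
    by (auto simp: carrier_log_Q)
  then have "z = of_rat (1 / of_nat n) * ln (of_rat q)"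
    by (simp add: of_rat_divide)
  with \<open>q > 0\<close> show "z \<in> carrier Q_log_Q"
    unfolding carrier_Q_log_Q by blast
qed

interpretation Q_log_Q: real_subgroup Q_log_Q
proof
  show "0 \<in> carrier Q_log_Q"
    by (auto simp: carrier_Q_log_Q intro!: exI[of _ "0::rat"] exI[of _ "1::rat"])
  show "x + y \<in> carrier Q_log_Q" if xy: "x \<in> carrier Q_log_Q" "y \<in> carrier Q_log_Q" for x y
  proof -
    obtain u m v n where u: "u \<in> carrier log_Q" "m \<ge> 1" "x = u / real m"
      and v: "v \<in> carrier log_Q" "n \<ge> 1" "y = v / real n"
      using xy by (auto simp: Q_log_Q_eq_quotients)
    \<comment> \<open>A sum of two products \<open>a * ln b\<close> is not visibly of that form;
      over a common denominator the numerators add inside \<open>log_Q\<close>.\<close>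
    have "x + y = (real n * u + real m * v) / real (m * n)"
      using u v by (simp add: field_simps)
    moreover have "real n * u + real m * v \<in> carrier log_Q"
      using u v by (intro log_Q.add_mem log_Q.of_nat_mult_mem)
    moreover have "m * n \<ge> 1" using u v by simp
    ultimately show ?thesis
      unfolding Q_log_Q_eq_quotients by blast
  qed
  show "- x \<in> carrier Q_log_Q" if "x \<in> carrier Q_log_Q" for x
  proof -
    obtain u n where "u \<in> carrier log_Q" "n \<ge> 1" "x = u / real n"
      using \<open>x \<in> carrier Q_log_Q\<close> by (auto simp: Q_log_Q_eq_quotients)
    then have "- x = (- u) / real n" "- u \<in> carrier log_Q" "n \<ge> 1"
      by (simp_all add: log_Q.uminus_mem)
    then show ?thesis
      unfolding Q_log_Q_eq_quotients by blast
  qed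
qed (simp_all add: Q_log_Q_def)

lemma scale_Q_log_Q: "scale Q_log_Q a x = of_rat a * x"
  by (simp add: Q_log_Q_def)

interpretation Q_log_Q: ic_ord_qvector_space Q_log_Q
proof
  show "scale Q_log_Q a x \<in> carrier Q_log_Q" if "x \<in> carrier Q_log_Q" for a x
  proof -
    obtain c b where "x = of_rat c * ln (of_rat b)" "b > 0"
      using \<open>x \<in> carrier Q_log_Q\<close> by (auto simp: carrier_Q_log_Q)
    then have "scale Q_log_Q a x = of_rat (a * c) * ln (of_rat b)" "b > 0"
      by (simp_all add: scale_Q_log_Q of_rat_mult)
    then show ?thesis
      unfolding carrier_Q_log_Q by blast
  qed
qed (auto simp: scale_Q_log_Q Q_log_Q.mult_eq Q_log_Q.leq_eq of_rat_add of_rat_mult algebra_simps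
    intro: mult_right_mono)

lemma log_N_subset_log_Q: "carrier log_N \<subseteq> carrier log_Q"
  using log_N.zero_mem diff_zero[symmetric] unfolding log_Q_eq_differences by blast

lemma log_Q_subset_Q_log_Q: "carrier log_Q \<subseteq> carrier Q_log_Q"
proof
  fix x assume "x \<in> carrier log_Q"
  moreover have "x = x / real 1" by simp
  ultimately show "x \<in> carrier Q_log_Q"
    unfolding Q_log_Q_eq_quotients by blast
qed

section \<open>The universal properties\<close>

lemma ln_mem_log_N: "n \<ge> 1 \<Longrightarrow> ln (real n) \<in> carrier log_N"
  by (auto simp: carrier_log_N)

lemma universal_log_N:
  "universal_baseless_entropy
     ord_comm_monoid (ord_comm_monoid :: ('v, 'n) ord_monoid_scheme \<Rightarrow> bool) ord_hom
     log_N (log_card :: 'e point set \<Rightarrow> real)"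
  unfolding universal_baseless_entropy_def
proof (intro conjI allI impI)
  show "ord_comm_monoid log_N" by unfold_locales
  show "baseless_entropy log_N (log_card :: 'e point set \<Rightarrow> real)"
    by (rule log_N.baseless_entropy_log_card[OF ln_mem_log_N])
  fix W :: "('v, 'n) ord_monoid_scheme" and H :: "'e point set \<Rightarrow> 'v"
  assume "ord_comm_monoid W \<and> baseless_entropy W H"
  then have W: "ord_comm_monoid W" and H: "baseless_entropy W H" by auto
  obtain \<phi> where H_eq: "\<And>P. P \<in> obj \<Longrightarrow> H P = \<phi> (card P)"
    and closed: "\<And>n. n \<ge> 1 \<Longrightarrow> \<phi> n \<in> carrier W"
    and mono: "\<And>m n. \<lbrakk>m \<ge> 1; m \<le> n\<rbrakk> \<Longrightarrow> \<phi> m \<preceq>\<^bsub>W\<^esub> \<phi> n"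
    and mult: "\<And>m n. \<lbrakk>m \<ge> 1; n \<ge> 1\<rbrakk> \<Longrightarrow> \<phi> (m * n) = \<phi> m \<otimes>\<^bsub>W\<^esub> \<phi> n"
    and one: "\<phi> 1 = \<one>\<^bsub>W\<^esub>"
    using baseless_entropy_obtains_card[OF W H] by blast
  \<comment> \<open>The graph of the forced map. It is monotone because \<open>ln\<close> reflects
    the order of positive integers, and additive because \<open>ln\<close> turns products into
    sums.\<close>
  define R where "R = (\<lambda>x w. \<exists>n\<ge>1. x = ln (real n) \<and> w = \<phi> n)"
  obtain t where t: "t \<in> ord_hom log_N W" "\<And>x w. \<lbrakk>x \<in> carrier log_N; R x w\<rbrakk> \<Longrightarrow> t x = w"
  proof (rule log_N.ord_hom_of_relation[OF W, of R])
    show "R (x + y) (v \<otimes>\<^bsub>W\<^esub> w)" if R: "R x v" "R y w" for x y v w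
    proof -
      obtain m n where "m \<ge> 1" "n \<ge> 1" "x = ln (real m)" "y = ln (real n)" "v = \<phi> m" "w = \<phi> n"
        using R by (auto simp: R_def)
      then show ?thesis
        unfolding R_def by (intro exI[of _ "m * n"]) (auto simp: ln_mult mult)
    qed
    show "R 0 \<one>\<^bsub>W\<^esub>"
      unfolding R_def using one by (intro exI[of _ 1]) auto
  qed (auto simp: R_def carrier_log_N intro: closed mono)
  have t_ln: "t (ln (real n)) = \<phi> n" if "n \<ge> 1" for n
    using that by (intro t(2)) (auto simp: R_def carrier_log_N)
  show "\<exists>!t. t \<in> ord_hom log_N W \<and> (\<forall>P\<in>obj. H P = t (log_card P))"
  proof (rule ex1I[of _ t])
    have "H P = t (log_card P)" if "P \<in> obj" for P
      using t_ln[OF obj_card_ge_1[OF that]] by (simp add: log_card_def H_eq[OF that])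
    then show "t \<in> ord_hom log_N W \<and> (\<forall>P\<in>obj. H P = t (log_card P))"
      using t(1) by blast
    fix u assume u: "u \<in> ord_hom log_N W \<and> (\<forall>P\<in>obj. H P = u (log_card P))"
    show "u = t"
    proof (rule extensionalityI[of _ "carrier log_N"])
      fix x assume "x \<in> carrier log_N"
      then obtain n where n: "n \<ge> 1" "x = ln (real n)" by (auto simp: carrier_log_N)
      \<comment> \<open>Every element of \<open>log_N\<close> is the value of
        \<open>log_card\<close> at some object, so the factorization leaves no freedom.\<close>
      obtain P :: "'e point set" where "P \<in> obj" "card P = n"
        using ex_obj_card[OF n(1)] .
      then show "u x = t x"
        using u n H_eq t_ln by (metis log_card_def)
    qed (use u t(1) in \<open>auto intro: ord_hom_extensional\<close>)
  qed
qed

lemma universal_log_Q: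
  "universal_baseless_entropy
     ord_ab_group (ord_ab_group :: ('v, 'n) ord_monoid_scheme \<Rightarrow> bool) ord_hom
     log_Q (log_card :: 'e point set \<Rightarrow> real)"
proof (rule universal_baseless_entropy_reflection[OF universal_log_N])
  show "ord_ab_group log_Q" by unfold_locales
  show "baseless_entropy log_Q (log_card :: 'e point set \<Rightarrow> real)"
    using ln_mem_log_N log_N_subset_log_Q by (intro log_Q.baseless_entropy_log_card) blast
  show "ord_comm_monoid W" if "ord_ab_group W" for W :: "('v, 'n) ord_monoid_scheme"
    using that by (simp add: ord_ab_group_def)
  show "\<exists>!t. t \<in> ord_hom log_Q W \<and> (\<forall>x\<in>carrier log_N. t x = s x)"
    if "ord_ab_group W" "s \<in> ord_hom log_N W" for W :: "('v, 'n) ord_monoid_scheme" and s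
    using that
    by (intro log_N.ord_hom_extend_differences log_Q_eq_differences log_Q.real_submonoid_axioms)
  show "restrict t (carrier log_N) \<in> ord_hom log_N W"
    if "t \<in> ord_hom log_Q W" for W :: "('v, 'n) ord_monoid_scheme" and t
    using that
    by (intro log_N.ord_hom_restrict[OF log_Q.real_submonoid_axioms] log_N_subset_log_Q)
qed

lemma universal_Q_log_Q:
  "universal_baseless_entropy
     ord_qvector_space (ord_qvector_space :: ('v, 'n) ord_qvect_scheme \<Rightarrow> bool) ord_linear_hom
     Q_log_Q (log_card :: 'e point set \<Rightarrow> real)"
proof (rule universal_baseless_entropy_reflection[OF universal_log_Q])
  show "ord_qvector_space Q_log_Q" by unfold_locales
  show "baseless_entropy Q_log_Q (log_card :: 'e point set \<Rightarrow> real)"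
    using ln_mem_log_N log_N_subset_log_Q log_Q_subset_Q_log_Q
    by (intro Q_log_Q.baseless_entropy_log_card) blast
  show "ord_ab_group W" if "ord_qvector_space W" for W :: "('v, 'n) ord_qvect_scheme"
    using that by (simp add: ord_qvector_space_def)
  show "\<exists>!t. t \<in> ord_linear_hom Q_log_Q W \<and> (\<forall>x\<in>carrier log_Q. t x = s x)"
    if "ord_qvector_space W" "s \<in> ord_hom log_Q W" for W :: "('v, 'n) ord_qvect_scheme" and s
    using that
    by (intro log_Q.ord_hom_extend_rational_span Q_log_Q_eq_quotients scale_Q_log_Q
        Q_log_Q.real_submonoid_axioms)
  show "restrict t (carrier log_Q) \<in> ord_hom log_Q W"
    if "t \<in> ord_linear_hom Q_log_Q W" for W :: "('v, 'n) ord_qvect_scheme" and t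
    using that unfolding ord_linear_hom_def
    by (intro log_Q.ord_hom_restrict[OF Q_log_Q.real_submonoid_axioms] log_Q_subset_Q_log_Q) auto
qed

theorem proposition19:
  "universal_baseless_entropy
       ord_comm_monoid (ord_comm_monoid :: 'v ord_monoid \<Rightarrow> bool) ord_hom
       log_N (log_card :: 'e point set \<Rightarrow> real)
   \<and> universal_baseless_entropy
       canc_ord_comm_monoid (canc_ord_comm_monoid :: 'v ord_monoid \<Rightarrow> bool) ord_hom
       log_N (log_card :: 'e point set \<Rightarrow> real)
   \<and> universal_baseless_entropy
       ic_ord_comm_monoid (ic_ord_comm_monoid :: 'v ord_monoid \<Rightarrow> bool) ord_hom
       log_N (log_card :: 'e point set \<Rightarrow> real)
   \<and> universal_baseless_entropy
       ord_ab_group (ord_ab_group :: 'v ord_monoid \<Rightarrow> bool) ord_hom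
       log_Q (log_card :: 'e point set \<Rightarrow> real)
   \<and> universal_baseless_entropy
       ic_ord_ab_group (ic_ord_ab_group :: 'v ord_monoid \<Rightarrow> bool) ord_hom
       log_Q (log_card :: 'e point set \<Rightarrow> real)
   \<and> universal_baseless_entropy
       ord_qvector_space (ord_qvector_space :: 'v ord_qvect \<Rightarrow> bool) ord_linear_hom
       Q_log_Q (log_card :: 'e point set \<Rightarrow> real)
   \<and> universal_baseless_entropy
       ic_ord_qvector_space (ic_ord_qvector_space :: 'v ord_qvect \<Rightarrow> bool) ord_linear_hom
       Q_log_Q (log_card :: 'e point set \<Rightarrow> real)"
proof (intro conjI)
  show N: "universal_baseless_entropy
       ord_comm_monoid (ord_comm_monoid :: 'v ord_monoid \<Rightarrow> bool) ord_hom
       log_N (log_card :: 'e point set \<Rightarrow> real)"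
    by (rule universal_log_N)
  \<comment> \<open>The cancellative and integrally closed cases all go this way: the universal
    object of the larger category already lies in the full subcategory.\<close>
  show "universal_baseless_entropy
       canc_ord_comm_monoid (canc_ord_comm_monoid :: 'v ord_monoid \<Rightarrow> bool) ord_hom
       log_N (log_card :: 'e point set \<Rightarrow> real)"
    by (rule universal_baseless_entropy_subcategory[OF N], rule log_N.canc_ord_comm_monoid_axioms)
      (rule canc_ord_comm_monoid.axioms(1))
  show "universal_baseless_entropy
       ic_ord_comm_monoid (ic_ord_comm_monoid :: 'v ord_monoid \<Rightarrow> bool) ord_hom
       log_N (log_card :: 'e point set \<Rightarrow> real)"
    by (rule universal_baseless_entropy_subcategory[OF N], rule log_N.ic_ord_comm_monoid_axioms)
      (rule ic_ord_comm_monoid.axioms(1))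
  show Q: "universal_baseless_entropy
       ord_ab_group (ord_ab_group :: 'v ord_monoid \<Rightarrow> bool) ord_hom
       log_Q (log_card :: 'e point set \<Rightarrow> real)"
    by (rule universal_log_Q)
  show "universal_baseless_entropy
       ic_ord_ab_group (ic_ord_ab_group :: 'v ord_monoid \<Rightarrow> bool) ord_hom
       log_Q (log_card :: 'e point set \<Rightarrow> real)"
    by (rule universal_baseless_entropy_subcategory[OF Q], rule log_Q.ic_ord_ab_group_axioms)
      (rule ic_ord_ab_group.axioms(1))
  show V: "universal_baseless_entropy
       ord_qvector_space (ord_qvector_space :: 'v ord_qvect \<Rightarrow> bool) ord_linear_hom
       Q_log_Q (log_card :: 'e point set \<Rightarrow> real)"
    by (rule universal_Q_log_Q)
  show "universal_baseless_entropy
       ic_ord_qvector_space (ic_ord_qvector_space :: 'v ord_qvect \<Rightarrow> bool) ord_linear_hom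
       Q_log_Q (log_card :: 'e point set \<Rightarrow> real)"
    by (rule universal_baseless_entropy_subcategory[OF V], rule Q_log_Q.ic_ord_qvector_space_axioms)
      (rule ic_ord_qvector_space.axioms(1))
qed

end
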